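(* Let $m\ge k$ and $L\ge2$ be integers, and assume $L>2$ if $m<2k$. Let $E$ be an $m\times k$ random matrix with independent $\mathcal N(0,1)$ entries. Then for any $\eta$ with $0<\eta<1-\frac{1}{\lfloor m/k\rfloor(L-1)}$, $$\mathscr D_{\mathrm a}(E,L)<8e\,m^{3/2}L^{-(1-\eta)\lfloor m/k\rfloor}$$ with probability at least $1-L^{-\eta\lfloor m/k\rfloor}e^{\eta/(1-\eta)}-e^{-2m}$.
   Context: For a $k\times m$ matrix $F$, finite $\mathscr A\subset\mathbb{R}$ and bounded $\mathscr X\subset\mathbb{R}^k$, $\mathscr D_{\mathrm s}(F,\mathscr A,\mathscr X):=\sup_{x\in\mathscr X}\inf_{q\in\mathscr A^m}\|x-Fq\|_2$; for an $m\times k$ matrix $E$, $\mathscr D_{\mathrm a}(E,\mathscr A,\mathscr X):=\inf\{\mathscr D_{\mathrm s}(F,\mathscr A,\mathscr X):FE=I_k\}$ (infimum over empty set is $+\infty$); and $\mathscr D_{\mathrm a}(E,L):=\inf_{|\mathscr A|=L}\mathscr D_{\mathrm a}(E,\mathscr A,B_1)$ with $B_1$ the closed unit Euclidean ball of $\mathbb{R}^k$. *)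

theory Defs
  imports "HOL-Probability.Probability"
begin

text \<open>Vectors in R^n are represented as functions nat => real (only indices < n matter);
  an r x c matrix is a function nat => nat => real (only row indices < r, column indices < c matter).\<close>

definition vnorm :: "nat \<Rightarrow> (nat \<Rightarrow> real) \<Rightarrow> real" where
  "vnorm n x = sqrt (\<Sum>i<n. (x i)\<^sup>2)"

definition mat_vec :: "nat \<Rightarrow> (nat \<Rightarrow> nat \<Rightarrow> real) \<Rightarrow> (nat \<Rightarrow> real) \<Rightarrow> (nat \<Rightarrow> real)" where
  "mat_vec c F q = (\<lambda>i. \<Sum>j<c. F i j * q j)"

definition unit_ball :: "nat \<Rightarrow> (nat \<Rightarrow> real) set" where
  "unit_ball k = {x. (\<forall>i\<ge>k. x i = 0) \<and> vnorm k x \<le> 1}"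

text \<open>D_s(F,A,X) for a k x m matrix F: sup over x in X of inf over q in A^m of ||x - Fq||_2
  (values in ereal, so inf over the empty set is +infinity).\<close>
definition D_s :: "nat \<Rightarrow> nat \<Rightarrow> (nat \<Rightarrow> nat \<Rightarrow> real) \<Rightarrow> real set \<Rightarrow> (nat \<Rightarrow> real) set \<Rightarrow> ereal" where
  "D_s k m F A X = (SUP x\<in>X. INF q\<in>{q. (\<forall>j<m. q j \<in> A) \<and> (\<forall>j\<ge>m. q j = 0)}.
       ereal (vnorm k (\<lambda>i. x i - mat_vec m F q i)))"

definition D_a :: "nat \<Rightarrow> nat \<Rightarrow> (nat \<Rightarrow> nat \<Rightarrow> real) \<Rightarrow> real set \<Rightarrow> (nat \<Rightarrow> real) set \<Rightarrow> ereal" where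
  "D_a m k E A X = (INF F\<in>{F. (\<forall>i<k. \<forall>j<k. (\<Sum>l<m. F i l * E l j) = (if i = j then 1 else 0))}.
       D_s k m F A X)"

definition D_aL :: "nat \<Rightarrow> nat \<Rightarrow> (nat \<Rightarrow> nat \<Rightarrow> real) \<Rightarrow> nat \<Rightarrow> ereal" where
  "D_aL m k E L = (INF A\<in>{A::real set. finite A \<and> card A = L}. D_a m k E A (unit_ball k))"

definition gauss_matrix :: "nat \<Rightarrow> nat \<Rightarrow> (nat \<times> nat \<Rightarrow> real) measure" where
  "gauss_matrix m k = (\<Pi>\<^sub>M ij\<in>{..<m} \<times> {..<k}. density lborel std_normal_density)"

end

theory Submission
  imports Defs "Jordan_Normal_Form.Determinant"
begin

text \<open>
  Cut the first \<open>k p\<close> rows of \<open>E\<close>, \<open>p = m div k\<close>, into \<open>k\<close> blocks of length \<open>p\<close> and let \<open>V\<close> combine each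
  block with the weights \<open>1, L, ..., L^(p-1)\<close>. For an alphabet of \<open>L\<close> equidistant points in \<open>[-Y, Y]\<close>,
  base-\<open>L\<close> expansions show that each coordinate of \<open>V q\<close> runs through a full uniform grid of step
  \<open>2 Y / (L - 1)\<close>. Put \<open>B = V E\<close> and take the dual \<open>F = B^(-1) V\<close>, so that \<open>x - F q = B^(-1) (B x - V q)\<close>.
  Rounding each coordinate of \<open>B x\<close> up or down, in the direction chosen by a derandomised unbiased
  rounding, gives an error of at most \<open>Y / (L - 1)\<close> times the Frobenius norm of \<open>B^(-1)\<close>; nearest-point
  rounding would lose a further factor \<open>sqrt k\<close>.

  By Cramer's rule the squared Frobenius norm is a sum of terms \<open>1 / (N Z_i^2)\<close>, where \<open>N\<close> is the squared
  norm of the weights and \<open>Z_i\<close>, the determinant divided by the norm of its \<open>i\<close>-th row of cofactors and by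
  \<open>sqrt N\<close>, is standard normal given the other rows. The \<open>Z_i\<close> are dependent and \<open>1 / Z_i^2\<close> has no mean, but
  \<open>\<Sum>i. 1 / Z_i^2 \<ge> r^2\<close> forces \<open>\<Sum>i. 1 / (1 + r^2 Z_i^2) \<ge> 1/2\<close>, and Markov's inequality for the latter sum
  loses only a factor \<open>k\<close>. With \<open>Y = 4 sqrt m\<close> a chi-square tail bound controls the row norms of \<open>E\<close>.
\<close>

subsection \<open>Determinants and cofactors of leading submatrices\<close>

definition lead_det :: "nat \<Rightarrow> (nat \<Rightarrow> nat \<Rightarrow> real) \<Rightarrow> real" where
  "lead_det n b = Determinant.det (mat n n (\<lambda>(i, j). b i j))"

definition lead_cofactor :: "nat \<Rightarrow> (nat \<Rightarrow> nat \<Rightarrow> real) \<Rightarrow> nat \<Rightarrow> nat \<Rightarrow> real" where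
  "lead_cofactor n b i j = cofactor (mat n n (\<lambda>(i, j). b i j)) i j"

lemma lead_det_expand_row: "i < n \<Longrightarrow> lead_det n b = (\<Sum>j<n. b i j * lead_cofactor n b i j)"
  unfolding lead_det_def lead_cofactor_def by (subst laplace_expansion_row[of _ n i]) auto

text \<open>An entry of \<open>adj A * A = det A * I\<close>. When the determinant is nonzero, the
  cofactors divided by it form a left inverse with transposed indices (Cramer's rule).\<close>

lemma lead_cofactor_orthogonal_columns:
  assumes "j < n" "j' < n"
  shows "(\<Sum>i<n. lead_cofactor n b i j * b i j') = (if j = j' then lead_det n b else 0)"
proof -
  let ?A = "mat n n (\<lambda>(i, j). b i j)"
  have "(adj_mat ?A * ?A) $$ (j, j') = (\<Sum>i<n. lead_cofactor n b i j * b i j')"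
    using assms by (simp add: adj_mat_def scalar_prod_def lead_cofactor_def atLeast0LessThan)
  moreover have "(adj_mat ?A * ?A) $$ (j, j') = (if j = j' then lead_det n b else 0)"
    using assms by (subst adj_mat(3)[of _ n]) (auto simp: lead_det_def)
  ultimately show ?thesis by simp
qed

text \<open>Deleting row \<open>i\<close> removes every place where the matrices may differ. This is
  what frees the cofactors of a row from the random entries of that row.\<close>

lemma lead_cofactor_cong_row:
  assumes "i < n" and "\<And>r c. r < n \<Longrightarrow> r \<noteq> i \<Longrightarrow> c < n \<Longrightarrow> b r c = b' r c"
  shows "lead_cofactor n b i j = lead_cofactor n b' i j"
proof -
  have "mat_delete (mat n n (\<lambda>(i, j). b i j)) i j = mat_delete (mat n n (\<lambda>(i, j). b' i j)) i j"
    using assms by (intro eq_matI) (auto simp: mat_delete_def)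
  then show ?thesis by (simp add: lead_cofactor_def cofactor_def)
qed

lemma lead_cofactor_last: "lead_cofactor (Suc n) b n n = lead_det n b"
proof -
  have "mat_delete (mat (Suc n) (Suc n) (\<lambda>(i, j). b i j)) n n = mat n n (\<lambda>(i, j). b i j)"
    by (intro eq_matI) (auto simp: mat_delete_def)
  then show ?thesis by (simp add: lead_cofactor_def cofactor_def lead_det_def)
qed

lemma measurable_lead_det:
  assumes "\<And>i j. i < n \<Longrightarrow> j < n \<Longrightarrow> (\<lambda>x. b x i j) \<in> borel_measurable M"
  shows "(\<lambda>x. lead_det n (b x)) \<in> borel_measurable M"
proof -
  have permutes_less: "p i < n" if "p permutes {0..<n}" "i < n" for p i
    using permutes_in_image[OF that(1), of i] that(2) by simp
  have "(\<lambda>x. \<Sum>p\<in>{p. p permutes {0..<n}}. signof p * (\<Prod>i = 0..<n. b x i (p i)))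
      \<in> borel_measurable M"
    by (intro borel_measurable_sum borel_measurable_times borel_measurable_prod
        borel_measurable_const assms) (auto simp: permutes_less)
  also have "(\<lambda>x. \<Sum>p\<in>{p. p permutes {0..<n}}. signof p * (\<Prod>i = 0..<n. b x i (p i)))
      = (\<lambda>x. lead_det n (b x))"
    unfolding lead_det_def by (subst Determinant.det_def'[of _ n])
      (auto intro!: ext sum.cong prod.cong arg_cong2[where f = "(*)"] simp: permutes_less)
  finally show ?thesis .
qed

lemma measurable_lead_cofactor:
  assumes "\<And>i j. i < n \<Longrightarrow> j < n \<Longrightarrow> (\<lambda>x. b x i j) \<in> borel_measurable M" and "i < n" "j < n"
  shows "(\<lambda>x. lead_cofactor n (b x) i j) \<in> borel_measurable M"
proof -
  \<comment> \<open>\<open>d\<close> is the matrix without row \<open>i\<close> and column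
    \<open>j\<close>, so a cofactor is a signed determinant of size \<open>n - 1\<close>.\<close>
  define d where "d x r c = b x (if r < i then r else Suc r) (if c < j then c else Suc c)" for x r c
  have "mat_delete (mat n n (\<lambda>(i, j). b x i j)) i j = mat (n - 1) (n - 1) (\<lambda>(r, c). d x r c)" for x
    using assms(2,3) by (intro eq_matI) (auto simp: mat_delete_def d_def)
  then have "lead_cofactor n (b x) i j = (-1) ^ (i + j) * lead_det (n - 1) (d x)" for x
    by (simp add: lead_cofactor_def cofactor_def lead_det_def)
  moreover have "(\<lambda>x. lead_det (n - 1) (d x)) \<in> borel_measurable M"
    using assms by (intro measurable_lead_det) (auto simp: d_def)
  ultimately show ?thesis by simp
qed

subsection \<open>Linear forms in Gaussian vectors\<close>

abbreviation std_gauss :: "real measure" where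
  "std_gauss \<equiv> density lborel std_normal_density"

abbreviation gauss_product :: "'i set \<Rightarrow> ('i \<Rightarrow> real) measure" where
  "gauss_product I \<equiv> \<Pi>\<^sub>M i\<in>I. std_gauss"

lemma prob_space_std_gauss: "prob_space std_gauss"
  by (rule prob_space_normal_density) simp

lemma product_prob_space_std_gauss: "product_prob_space (\<lambda>_. std_gauss)"
  by (rule product_prob_spaceI) (rule prob_space_std_gauss)

lemma prob_space_gauss_product: "prob_space (gauss_product I)"
  by (rule prob_space_PiM) (rule prob_space_std_gauss)

lemma distr_gauss_product_component:
  assumes "finite I" "i \<in> I"
  shows "distr (gauss_product I) borel (\<lambda>x. x i) = std_gauss"
  using distr_PiM_component[of I "\<lambda>_. std_gauss" i] assms prob_space_std_gauss
  by (simp cong: distr_cong)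

lemma distr_gauss_product_linear:
  assumes I: "finite I" and a: "\<exists>i\<in>I. a i \<noteq> 0"
  shows "distr (gauss_product I) borel (\<lambda>x. (\<Sum>i\<in>I. a i * x i) / sqrt (\<Sum>i\<in>I. (a i)\<^sup>2)) = std_gauss"
proof -
  interpret P: prob_space "gauss_product I" by (rule prob_space_gauss_product)
  \<comment> \<open>Zero coefficients are dropped because \<open>sum_indep_normal\<close> asks for
    positive standard deviations; \<open>K\<close> is nonempty by the hypothesis on
    \<open>a\<close>.\<close>
  define K where "K = {i\<in>I. a i \<noteq> 0}"
  have K: "finite K" "K \<noteq> {}" "K \<subseteq> I" using I a by (auto simp: K_def)
  have indep: "P.indep_vars (\<lambda>_. borel) (\<lambda>i x. x i) I"
  proof (subst P.indep_vars_iff_distr_eq_PiM')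
    show "I \<noteq> {}" using a by auto
    show "distr (gauss_product I) (Pi\<^sub>M I (\<lambda>i. borel)) (\<lambda>x. \<lambda>i\<in>I. x i) =
      Pi\<^sub>M I (\<lambda>i. distr (gauss_product I) borel (\<lambda>x. x i))"
    proof -
      have "distr (gauss_product I) (Pi\<^sub>M I (\<lambda>i. borel)) (\<lambda>x. \<lambda>i\<in>I. x i)
          = distr (gauss_product I) (gauss_product I) (\<lambda>x. x)"
        by (intro distr_cong sets_PiM_cong) (auto simp: space_PiM PiE_restrict)
      also have "\<dots> = gauss_product I" by (rule distr_id)
      also have "\<dots> = Pi\<^sub>M I (\<lambda>i. distr (gauss_product I) borel (\<lambda>x. x i))"
        by (intro PiM_cong refl distr_gauss_product_component[OF I, symmetric])
      finally show ?thesis .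
    qed
  qed auto
  have indepK: "P.indep_vars (\<lambda>_. borel) (\<lambda>i x. a i * x i) K"
    using P.indep_vars_compose2[OF P.indep_vars_subset[OF indep K(3)], of "\<lambda>i x. a i * x" "\<lambda>_. borel"]
    by simp
  have "distributed (gauss_product I) lborel (\<lambda>x. \<Sum>i\<in>K. a i * x i)
      (normal_density (\<Sum>i\<in>K. 0) (sqrt (\<Sum>i\<in>K. \<bar>a i\<bar>\<^sup>2)))"
  proof (rule P.sum_indep_normal[OF K(1,2) indepK])
    fix i assume i: "i \<in> K"
    then show "0 < \<bar>a i\<bar>" by (simp add: K_def)
    have "distributed (gauss_product I) lborel (\<lambda>x. x i) std_normal_density"
      unfolding distributed_def using distr_gauss_product_component[OF I, of i] i K(3)
      by (auto cong: distr_cong)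
    from P.normal_density_affine[OF this, of "a i" 0] i
    show "distributed (gauss_product I) lborel (\<lambda>x. a i * x i) (normal_density 0 \<bar>a i\<bar>)"
      by (simp add: K_def)
  qed
  moreover have "(\<Sum>i\<in>K. a i * x i) = (\<Sum>i\<in>I. a i * x i)" for x
    using I by (intro sum.mono_neutral_left) (auto simp: K_def)
  moreover have sq: "(\<Sum>i\<in>K. \<bar>a i\<bar>\<^sup>2) = (\<Sum>i\<in>I. (a i)\<^sup>2)"
    using I unfolding power2_abs by (intro sum.mono_neutral_left) (auto simp: K_def)
  ultimately have "distributed (gauss_product I) lborel (\<lambda>x. \<Sum>i\<in>I. a i * x i)
      (normal_density 0 (sqrt (\<Sum>i\<in>I. (a i)\<^sup>2)))"
    by simp
  moreover have "0 < (\<Sum>i\<in>K. (a i)\<^sup>2)" using K by (intro sum_pos) (auto simp: K_def)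
  ultimately have "distributed (gauss_product I) lborel
      (\<lambda>x. (\<Sum>i\<in>I. a i * x i) / sqrt (\<Sum>i\<in>I. (a i)\<^sup>2)) std_normal_density"
    using sq by (subst (asm) P.normal_standard_normal_convert) simp_all
  then show ?thesis unfolding distributed_def by (auto cong: distr_cong)
qed

lemma nn_integral_gauss_conditional_linear:
  fixes a :: "('i \<Rightarrow> real) \<Rightarrow> 'i \<Rightarrow> real" and f :: "real \<Rightarrow> ennreal"
  assumes K: "finite K" "I \<subseteq> K" and f[measurable]: "f \<in> borel_measurable borel"
    and a[measurable]: "\<And>i. i \<in> I \<Longrightarrow> (\<lambda>x. a x i) \<in> borel_measurable (gauss_product K)"
    and indep: "\<And>x x' i. (\<And>j. j \<in> K - I \<Longrightarrow> x j = x' j) \<Longrightarrow> i \<in> I \<Longrightarrow> a x i = a x' i"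
    and nz: "AE x in gauss_product K. \<exists>i\<in>I. a x i \<noteq> 0"
  shows "(\<integral>\<^sup>+x. f ((\<Sum>i\<in>I. a x i * x i) / sqrt (\<Sum>i\<in>I. (a x i)\<^sup>2)) \<partial>gauss_product K)
      = (\<integral>\<^sup>+z. f z \<partial>std_gauss)"
proof -
  let ?J = "K - I"
  define Z where "Z x = (\<Sum>i\<in>I. a x i * x i) / sqrt (\<Sum>i\<in>I. (a x i)\<^sup>2)" for x
  have I: "finite I" "finite ?J" "?J \<inter> I = {}" "?J \<union> I = K" using K finite_subset by auto
  have comp[measurable]: "(\<lambda>x. x i) \<in> borel_measurable (gauss_product K)" if "i \<in> I" for i
    using measurable_component_singleton[of i K "\<lambda>_. std_gauss"] that K(2) by auto
  have Zm[measurable]: "Z \<in> borel_measurable (gauss_product K)" unfolding Z_def by measurable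
  have aeq: "a (merge ?J I (y, x)) i = a y i" if "i \<in> I" for x y i
    using that by (intro indep) auto
  have Nm: "{x\<in>space (gauss_product K). \<not> (\<exists>i\<in>I. a x i \<noteq> 0)} \<in> sets (gauss_product K)"
    using I by measurable
  interpret G: product_prob_space "\<lambda>_. std_gauss" K by (rule product_prob_space_std_gauss)
  interpret PI: prob_space "gauss_product I" by (rule prob_space_gauss_product)
  have mg: "(\<lambda>x. merge ?J I (y, x)) \<in> measurable (gauss_product I) (gauss_product K)"
    if "y \<in> space (gauss_product ?J)" for y
    using measurable_compose[OF measurable_Pair1'[OF that] measurable_merge[of ?J I "\<lambda>_. std_gauss"]] I(4) by simp
  \<comment> \<open>The exceptional set ignores the coordinates in \<open>I\<close>, so integrating
    these out turns its measure into that of its projection to \<open>K - I\<close>.\<close>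
  have nzJ: "AE y in gauss_product ?J. \<exists>i\<in>I. a y i \<noteq> 0"
  proof -
    have "0 = (\<integral>\<^sup>+x. indicator {x\<in>space (gauss_product K). \<not> (\<exists>i\<in>I. a x i \<noteq> 0)} x \<partial>gauss_product K)"
      using nz Nm by (subst nn_integral_indicator) (auto simp: AE_iff_measurable[OF Nm])
    also have "\<dots> = (\<integral>\<^sup>+y. (\<integral>\<^sup>+x. indicator {x\<in>space (gauss_product K). \<not> (\<exists>i\<in>I. a x i \<noteq> 0)} (merge ?J I (y, x))
        \<partial>gauss_product I) \<partial>gauss_product ?J)"
      using Nm by (intro G.product_nn_integral_fold[OF I(3) I(2) I(1), unfolded I(4)]) auto
    also have "\<dots> = (\<integral>\<^sup>+y. indicator {y\<in>space (gauss_product ?J). \<not> (\<exists>i\<in>I. a y i \<noteq> 0)} y \<partial>gauss_product ?J)"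
    proof (intro nn_integral_cong)
      fix y assume y: "y \<in> space (gauss_product ?J)"
      have "(\<integral>\<^sup>+x. indicator {x\<in>space (gauss_product K). \<not> (\<exists>i\<in>I. a x i \<noteq> 0)} (merge ?J I (y, x)) \<partial>gauss_product I)
        = (\<integral>\<^sup>+x. indicator {y\<in>space (gauss_product ?J). \<not> (\<exists>i\<in>I. a y i \<noteq> 0)} y \<partial>gauss_product I)"
        using y measurable_space[OF mg[OF y]] by (intro nn_integral_cong) (auto simp: indicator_def aeq)
      then show "(\<integral>\<^sup>+x. indicator {x\<in>space (gauss_product K). \<not> (\<exists>i\<in>I. a x i \<noteq> 0)} (merge ?J I (y, x)) \<partial>gauss_product I)
        = indicator {y\<in>space (gauss_product ?J). \<not> (\<exists>i\<in>I. a y i \<noteq> 0)} y"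
        by (simp add: PI.emeasure_space_1)
    qed
    finally have *: "(\<integral>\<^sup>+y. indicator {y\<in>space (gauss_product ?J). \<not> (\<exists>i\<in>I. a y i \<noteq> 0)} y \<partial>gauss_product ?J) = 0"
      by simp
    have am: "(\<lambda>y. a y i) \<in> borel_measurable (gauss_product ?J)" if "i \<in> I" for i
    proof -
      \<comment> \<open>Any fixed filling of the \<open>I\<close> coordinates, here by zero,
        exhibits the coefficient as a measurable function of the others.\<close>
      have "(\<lambda>y. a (merge ?J I (y, \<lambda>_\<in>I. 0)) i) \<in> borel_measurable (gauss_product ?J)"
        using measurable_compose[OF measurable_compose[OF measurable_Pair2'[of "\<lambda>_\<in>I. 0" "gauss_product I"]
           measurable_merge[of ?J I "\<lambda>_. std_gauss"]], of "\<lambda>x. a x i" borel] a[OF that] I(4)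
        by (auto simp: space_PiM)
      then show ?thesis by (simp add: aeq[OF that])
    qed
    have Nj: "{y\<in>space (gauss_product ?J). \<not> (\<exists>i\<in>I. a y i \<noteq> 0)} \<in> sets (gauss_product ?J)"
      using I am by measurable
    show ?thesis using * Nj by (simp add: AE_iff_measurable[OF Nj])
  qed
  have "(\<integral>\<^sup>+x. f (Z x) \<partial>gauss_product K) = (\<integral>\<^sup>+y. (\<integral>\<^sup>+x. f (Z (merge ?J I (y, x))) \<partial>gauss_product I) \<partial>gauss_product ?J)"
    using G.product_nn_integral_fold[OF I(3) I(2) I(1), of "\<lambda>x. f (Z x)"] I(4) by simp
  also have "\<dots> = (\<integral>\<^sup>+y. (\<integral>\<^sup>+z. f z \<partial>std_gauss) \<partial>gauss_product ?J)"
  proof (rule nn_integral_cong_AE, use nzJ in eventually_elim)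
    fix y assume y: "\<exists>i\<in>I. a y i \<noteq> 0"
    have Z: "Z (merge ?J I (y, x)) = (\<Sum>i\<in>I. a y i * x i) / sqrt (\<Sum>i\<in>I. (a y i)\<^sup>2)" for x
      unfolding Z_def by (intro arg_cong2[where f = "(/)"] arg_cong[where f = sqrt] sum.cong) (auto simp: aeq)
    have "(\<integral>\<^sup>+z. f z \<partial>std_gauss) = (\<integral>\<^sup>+z. f z \<partial>distr (gauss_product I) borel
        (\<lambda>x. (\<Sum>i\<in>I. a y i * x i) / sqrt (\<Sum>i\<in>I. (a y i)\<^sup>2)))"
      using distr_gauss_product_linear[OF I(1) y] by simp
    also have "\<dots> = (\<integral>\<^sup>+x. f ((\<Sum>i\<in>I. a y i * x i) / sqrt (\<Sum>i\<in>I. (a y i)\<^sup>2)) \<partial>gauss_product I)"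
      by (intro nn_integral_distr borel_measurable_divide borel_measurable_sum borel_measurable_times
          borel_measurable_const measurable_compose[OF measurable_component_singleton]) auto
    finally show "(\<integral>\<^sup>+x. f (Z (merge ?J I (y, x))) \<partial>gauss_product I) = (\<integral>\<^sup>+z. f z \<partial>std_gauss)"
      by (simp add: Z)
  qed
  also have "\<dots> = (\<integral>\<^sup>+z. f z \<partial>std_gauss)"
    using prob_space.emeasure_space_1[OF prob_space_gauss_product[of "K - I"]] by simp
  finally show ?thesis unfolding Z_def .
qed

text \<open>The moment generating function of a chi-square variable at 1/4: up to the factor
  \<open>sqrt 2\<close>, the integrand is the normal density of variance 2.\<close>

lemma nn_integral_exp_quarter_square:
  "(\<integral>\<^sup>+x. ennreal (exp (x\<^sup>2 / 4)) \<partial>std_gauss) = ennreal (sqrt 2)"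
proof -
  have "std_normal_density x * exp (x\<^sup>2 / 4) = sqrt 2 * normal_density 0 (sqrt 2) x" for x
    by (simp add: normal_density_def real_sqrt_mult field_simps flip: exp_add)
  then have "(\<integral>\<^sup>+x. ennreal (exp (x\<^sup>2 / 4)) \<partial>std_gauss)
      = (\<integral>\<^sup>+x. ennreal (sqrt 2) * ennreal (normal_density 0 (sqrt 2) x) \<partial>lborel)"
    by (subst nn_integral_density) (auto simp flip: ennreal_mult)
  also have "\<dots> = ennreal (sqrt 2) * emeasure (density lborel (normal_density 0 (sqrt 2))) UNIV"
    by (subst nn_integral_cmult) (auto simp: emeasure_density)
  also have "\<dots> = ennreal (sqrt 2)"
    using prob_space.emeasure_space_1[OF prob_space_normal_density[of "sqrt 2" 0]] by simp
  finally show ?thesis .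
qed

text \<open>The antiderivative \<open>arctan (r * z) / r\<close> settles the right half-line and
  reflection the left one. The point 0 lies in both, whence an inequality.\<close>

lemma nn_integral_cauchy_lborel:
  assumes "0 < r"
  shows "(\<integral>\<^sup>+z. ennreal (1 / (1 + (r * z)\<^sup>2)) \<partial>lborel) \<le> ennreal (pi / r)"
proof -
  let ?f = "\<lambda>z::real. 1 / (1 + (r * z)\<^sup>2)"
  have d: "DERIV (\<lambda>z. arctan (r * z) / r) z :> ?f z" for z
  proof -
    have "DERIV (\<lambda>z. arctan (r * z) / r) z :> inverse (1 + (r * z)\<^sup>2) * (r * 1) / r"
      by (intro DERIV_cdivide DERIV_chain2[OF DERIV_arctan] DERIV_cmult DERIV_ident)
    then show ?thesis using assms by (simp add: inverse_eq_divide)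
  qed
  have half: "(\<integral>\<^sup>+z. ennreal (?f z) * indicator {0..} z \<partial>lborel) = ennreal (pi / (2 * r))"
  proof -
    have "filterlim (\<lambda>z. r * z) at_top at_top"
      using assms by (intro filterlim_tendsto_pos_mult_at_top[OF tendsto_const]) (auto simp: filterlim_ident)
    then have "((\<lambda>z. arctan (r * z) / r) \<longlongrightarrow> (pi / 2) / r) at_top"
      using assms by (intro tendsto_divide filterlim_compose[OF tendsto_arctan_at_top]) auto
    then have "(\<integral>\<^sup>+z. ennreal (?f z) * indicator {0..} z \<partial>lborel) = ennreal ((pi / 2) / r - arctan (r * 0) / r)"
      by (intro nn_integral_FTC_atLeast d) (auto)
    then show ?thesis by simp
  qed
  have neg: "(\<integral>\<^sup>+z. ennreal (?f z) * indicator {..0} z \<partial>lborel) = ennreal (pi / (2 * r))"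
  proof -
    have "(\<integral>\<^sup>+z. ennreal (?f z) * indicator {..0} z \<partial>lborel)
      = (\<integral>\<^sup>+z. ennreal (?f z) * indicator {..0} z \<partial>distr lborel borel uminus)"
      by (simp add: lborel_distr_uminus)
    also have "\<dots> = (\<integral>\<^sup>+z. ennreal (?f z) * indicator {0..} z \<partial>lborel)"
      by (subst nn_integral_distr) (auto intro!: nn_integral_cong simp: indicator_def)
    finally show ?thesis using half by simp
  qed
  have "(\<integral>\<^sup>+z. ennreal (?f z) \<partial>lborel)
      \<le> (\<integral>\<^sup>+z. ennreal (?f z) * indicator {0..} z + ennreal (?f z) * indicator {..0} z \<partial>lborel)"
    by (intro nn_integral_mono) (auto simp: indicator_def)
  also have "\<dots> = ennreal (pi / (2 * r)) + ennreal (pi / (2 * r))"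
    by (subst nn_integral_add) (auto simp: half neg)
  also have "\<dots> = ennreal (pi / r)"
    using assms by (simp flip: ennreal_plus)
  finally show ?thesis .
qed

text \<open>Bounding the Gaussian density by its maximum \<open>1 / sqrt (2 * pi)\<close> reduces
  this to the Cauchy integral.\<close>

lemma nn_integral_cauchy_std_gauss:
  assumes "0 < r"
  shows "(\<integral>\<^sup>+z. ennreal (1 / (1 + (r * z)\<^sup>2)) \<partial>std_gauss) \<le> ennreal (sqrt (pi / 2) / r)"
proof -
  have le: "std_normal_density z \<le> 1 / sqrt (2 * pi)" for z
    by (simp add: std_normal_density_def divide_right_mono)
  have "(\<integral>\<^sup>+z. ennreal (1 / (1 + (r * z)\<^sup>2)) \<partial>std_gauss)
      = (\<integral>\<^sup>+z. ennreal (std_normal_density z) * ennreal (1 / (1 + (r * z)\<^sup>2)) \<partial>lborel)"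
    by (subst nn_integral_density) auto
  also have "\<dots> \<le> (\<integral>\<^sup>+z. ennreal (1 / sqrt (2 * pi)) * ennreal (1 / (1 + (r * z)\<^sup>2)) \<partial>lborel)"
    by (intro nn_integral_mono mult_right_mono ennreal_leI le) auto
  also have "\<dots> = ennreal (1 / sqrt (2 * pi)) * (\<integral>\<^sup>+z. ennreal (1 / (1 + (r * z)\<^sup>2)) \<partial>lborel)"
    by (subst nn_integral_cmult) auto
  also have "\<dots> \<le> ennreal (1 / sqrt (2 * pi)) * ennreal (pi / r)"
    by (intro mult_left_mono nn_integral_cauchy_lborel assms) auto
  also have "\<dots> = ennreal (1 / sqrt (2 * pi) * (pi / r))"
    using assms by (subst ennreal_mult) auto
  also have "1 / sqrt (2 * pi) * (pi / r) = sqrt (pi / 2) / r"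
    using assms by (simp add: real_sqrt_mult real_sqrt_divide field_simps)
  finally show ?thesis .
qed

subsection \<open>Determinant of the compressed Gaussian matrix\<close>

lemma gauss_matrix_eq: "gauss_matrix m k = gauss_product ({..<m} \<times> {..<k})"
  by (simp add: gauss_matrix_def)

lemma measurable_gauss_matrix_entry:
  "l < m \<Longrightarrow> j < k \<Longrightarrow> (\<lambda>x. x (l, j)) \<in> borel_measurable (gauss_matrix m k)"
  unfolding gauss_matrix_eq
  using measurable_component_singleton[of "(l, j)" "{..<m} \<times> {..<k}" "\<lambda>_. std_gauss"] by auto

text \<open>Chernoff's bound with exponent 1/4: by independence every squared coordinate contributes
  a factor \<open>sqrt 2\<close>.\<close>

lemma emeasure_gauss_product_sum_squares_le:
  assumes "finite K" "I \<subseteq> K"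
  shows "emeasure (gauss_product K) {x\<in>space (gauss_product K). t \<le> (\<Sum>i\<in>I. (x i)\<^sup>2)}
    \<le> ennreal (exp (- t / 4) * sqrt 2 ^ card I)"
proof -
  let ?M = "gauss_product K"
  interpret G: product_prob_space "\<lambda>_. std_gauss" K by (rule product_prob_space_std_gauss)
  \<comment> \<open>\<open>g i\<close> is 1 off \<open>I\<close>, so that the exponential is a
    product over all of \<open>K\<close>.\<close>
  define g where "g i z = ennreal (if i \<in> I then exp (z\<^sup>2 / 4) else 1)" for i and z :: real
  have g[measurable]: "g i \<in> borel_measurable borel" for i unfolding g_def by measurable
  have comp[measurable]: "(\<lambda>x. x i) \<in> borel_measurable ?M" if "i \<in> I" for i
    using measurable_component_singleton[of i K "\<lambda>_. std_gauss"] that assms(2) by auto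
  have u: "ennreal (exp ((\<Sum>i\<in>I. (x i)\<^sup>2) / 4)) = (\<Prod>i\<in>K. g i (x i))" for x
  proof -
    have "(\<Prod>i\<in>K. g i (x i)) = ennreal (\<Prod>i\<in>K. if i \<in> I then exp ((x i)\<^sup>2 / 4) else 1)"
      unfolding g_def by (rule prod_ennreal) auto
    also have "(\<Prod>i\<in>K. if i \<in> I then exp ((x i)\<^sup>2 / 4) else 1) = (\<Prod>i\<in>I. exp ((x i)\<^sup>2 / 4))"
      using assms by (simp add: prod.If_cases Int_absorb1)
    also have "\<dots> = exp ((\<Sum>i\<in>I. (x i)\<^sup>2) / 4)"
      using finite_subset[OF assms(2,1)] by (simp add: exp_sum sum_divide_distrib)
    finally show ?thesis by simp
  qed
  have int: "(\<integral>\<^sup>+x. ennreal (exp ((\<Sum>i\<in>I. (x i)\<^sup>2) / 4)) \<partial>?M) = ennreal (sqrt 2 ^ card I)"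
  proof -
    have "(\<integral>\<^sup>+x. ennreal (exp ((\<Sum>i\<in>I. (x i)\<^sup>2) / 4)) \<partial>?M) = (\<Prod>i\<in>K. integral\<^sup>N std_gauss (g i))"
      unfolding u by (rule G.product_nn_integral_prod) (use assms in auto)
    also have "\<dots> = (\<Prod>i\<in>K. if i \<in> I then ennreal (sqrt 2) else 1)"
      using prob_space.emeasure_space_1[OF prob_space_std_gauss]
      by (intro prod.cong refl) (auto simp: g_def[abs_def] nn_integral_exp_quarter_square)
    also have "\<dots> = ennreal (sqrt 2 ^ card I)"
      using assms by (simp add: prod.If_cases Int_absorb1 ennreal_power)
    finally show ?thesis .
  qed
  have "emeasure ?M {x\<in>space ?M. t \<le> (\<Sum>i\<in>I. (x i)\<^sup>2)}
      = emeasure ?M {x\<in>space ?M. 1 \<le> ennreal (exp (- t / 4)) * ennreal (exp ((\<Sum>i\<in>I. (x i)\<^sup>2) / 4))}"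
    by (intro arg_cong[where f = "emeasure ?M"]) (auto simp flip: ennreal_mult exp_add)
  also have "\<dots> \<le> ennreal (exp (- t / 4)) * (\<integral>\<^sup>+x. ennreal (exp ((\<Sum>i\<in>I. (x i)\<^sup>2) / 4)) * indicator (space ?M) x \<partial>?M)"
    by (rule nn_integral_Markov_inequality) auto
  also have "\<dots> = ennreal (exp (- t / 4)) * (\<integral>\<^sup>+x. ennreal (exp ((\<Sum>i\<in>I. (x i)\<^sup>2) / 4)) \<partial>?M)"
    by (intro arg_cong2[where f = "(*)"] nn_integral_cong) auto
  also have "\<dots> = ennreal (exp (- t / 4) * sqrt 2 ^ card I)"
    unfolding int by (rule ennreal_mult[symmetric]) auto
  finally show ?thesis .
qed

text \<open>The matrix product \<open>V E\<close>, where \<open>x\<close> holds the entries of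
  \<open>E\<close> indexed by pairs.\<close>

definition compress :: "nat \<Rightarrow> (nat \<Rightarrow> nat \<Rightarrow> real) \<Rightarrow> (nat \<times> nat \<Rightarrow> real) \<Rightarrow> nat \<Rightarrow> nat \<Rightarrow> real" where
  "compress m V x i j = (\<Sum>l<m. V i l * x (l, j))"

text \<open>By \<open>x / 0 = 0\<close> the value is \<open>0\<close> where all cofactors vanish; such points are counted as bad.\<close>

definition normalized_det :: "nat \<Rightarrow> (nat \<Rightarrow> nat \<Rightarrow> real) \<Rightarrow> nat \<Rightarrow> nat \<Rightarrow> (nat \<times> nat \<Rightarrow> real) \<Rightarrow> real" where
  "normalized_det m V n i x = lead_det n (compress m V x)
    / (sqrt (\<Sum>l<m. (V i l)\<^sup>2) * sqrt (\<Sum>j<n. (lead_cofactor n (compress m V x) i j)\<^sup>2))"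

lemma measurable_compress: "j < k \<Longrightarrow> (\<lambda>x. compress m V x i j) \<in> borel_measurable (gauss_matrix m k)"
  unfolding compress_def
  by (intro borel_measurable_sum borel_measurable_times borel_measurable_const
      measurable_gauss_matrix_entry) auto

lemma measurable_normalized_det:
  assumes "n \<le> k" "i < n"
  shows "normalized_det m V n i \<in> borel_measurable (gauss_matrix m k)"
proof -
  have [measurable]: "(\<lambda>x. lead_det n (compress m V x)) \<in> borel_measurable (gauss_matrix m k)"
    using assms by (intro measurable_lead_det measurable_compress) auto
  have [measurable]: "(\<lambda>x. lead_cofactor n (compress m V x) i j) \<in> borel_measurable (gauss_matrix m k)" if "j \<in> {..<n}" for j
    using assms that by (intro measurable_lead_cofactor measurable_compress) auto
  show ?thesis unfolding normalized_det_def by measurable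
qed

context
  fixes m k :: nat and V :: "nat \<Rightarrow> nat \<Rightarrow> real"
  assumes disjoint: "\<And>i i' l. V i l \<noteq> 0 \<Longrightarrow> V i' l \<noteq> 0 \<Longrightarrow> i = i'"
    and nonzero: "\<And>i. i < k \<Longrightarrow> \<exists>l<m. V i l \<noteq> 0"
begin

text \<open>Laplace expansion along row \<open>i\<close> makes the determinant a linear form in the
  Gaussian entries that feed this row. Since the rows of \<open>V\<close> have disjoint supports,
  its coefficients do not depend on those entries, and their Euclidean norm is the denominator of
  \<open>normalized_det\<close>.\<close>

lemma nn_integral_normalized_det:
  fixes f :: "real \<Rightarrow> ennreal"
  assumes n: "n \<le> k" "i < n" and f: "f \<in> borel_measurable borel"
    and nz: "AE x in gauss_matrix m k. \<exists>j<n. lead_cofactor n (compress m V x) i j \<noteq> 0"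
  shows "(\<integral>\<^sup>+x. f (normalized_det m V n i x) \<partial>gauss_matrix m k) = (\<integral>\<^sup>+z. f z \<partial>std_gauss)"
proof -
  \<comment> \<open>Only the support \<open>R\<close> of row \<open>i\<close> of \<open>V\<close>
    supplies variables of the form; the cofactors may depend on the other Gaussian rows.\<close>
  define R where "R = {l\<in>{..<m}. V i l \<noteq> 0}"
  define a where "a x = (\<lambda>(l, j). V i l * lead_cofactor n (compress m V x) i j)" for x
  let ?K = "{..<m} \<times> {..<k}" and ?I = "R \<times> {..<n}"
  have R: "finite R" by (simp add: R_def)
  have sum_R: "(\<Sum>l\<in>R. V i l * g l) = (\<Sum>l<m. V i l * g l)" for g
    unfolding R_def by (intro sum.mono_neutral_left) auto
  have "normalized_det m V n i x = (\<Sum>e\<in>?I. a x e * x e) / sqrt (\<Sum>e\<in>?I. (a x e)\<^sup>2)" for x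
  proof -
    have "(\<Sum>e\<in>?I. a x e * x e) = (\<Sum>l\<in>R. \<Sum>j<n. V i l * (x (l, j) * lead_cofactor n (compress m V x) i j))"
      unfolding sum.cartesian_product a_def by (intro sum.cong) (auto simp: mult_ac)
    also have "\<dots> = (\<Sum>j<n. \<Sum>l\<in>R. V i l * (x (l, j) * lead_cofactor n (compress m V x) i j))" by (rule sum.swap)
    also have "\<dots> = (\<Sum>j<n. compress m V x i j * lead_cofactor n (compress m V x) i j)"
      by (simp add: sum_R compress_def sum_distrib_right mult.assoc)
    also have "\<dots> = lead_det n (compress m V x)" using lead_det_expand_row[OF n(2)] by simp
    finally have 1: "(\<Sum>e\<in>?I. a x e * x e) = lead_det n (compress m V x)" .
    have "(\<Sum>e\<in>?I. (a x e)\<^sup>2) = (\<Sum>l\<in>R. \<Sum>j<n. (V i l)\<^sup>2 * (lead_cofactor n (compress m V x) i j)\<^sup>2)"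
      unfolding sum.cartesian_product a_def by (intro sum.cong) (auto simp: power_mult_distrib)
    also have "\<dots> = (\<Sum>l\<in>R. (V i l)\<^sup>2) * (\<Sum>j<n. (lead_cofactor n (compress m V x) i j)\<^sup>2)" by (rule sum_product[symmetric])
    also have "(\<Sum>l\<in>R. (V i l)\<^sup>2) = (\<Sum>l<m. (V i l)\<^sup>2)"
      using sum_R[of "V i"] by (simp add: power2_eq_square)
    finally show ?thesis unfolding 1 normalized_det_def by (simp add: real_sqrt_mult)
  qed
  moreover have "(\<integral>\<^sup>+x. f ((\<Sum>e\<in>?I. a x e * x e) / sqrt (\<Sum>e\<in>?I. (a x e)\<^sup>2)) \<partial>gauss_product ?K)
      = (\<integral>\<^sup>+z. f z \<partial>std_gauss)"
  proof (rule nn_integral_gauss_conditional_linear[OF _ _ f])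
    show "?I \<subseteq> ?K" using n by (auto simp: R_def)
    show "(\<lambda>x. a x e) \<in> borel_measurable (gauss_product ?K)" if "e \<in> ?I" for e
    proof -
      obtain l j where e: "e = (l, j)" "j < n" using \<open>e \<in> ?I\<close> by auto
      have "(\<lambda>x. lead_cofactor n (compress m V x) i j) \<in> borel_measurable (gauss_matrix m k)"
        using n e by (intro measurable_lead_cofactor measurable_compress) auto
      then show ?thesis by (simp add: a_def e gauss_matrix_eq)
    qed
    show "a x e = a x' e" if eq: "\<And>e. e \<in> ?K - ?I \<Longrightarrow> x e = x' e" and "e \<in> ?I" for x x' e
    proof -
      \<comment> \<open>A row \<open>r\<close> other than \<open>i\<close> reads only Gaussian rows
        outside \<open>R\<close>, hence coordinates on which \<open>x\<close> and \<open>x'\<close>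
        agree.\<close>
      have "compress m V x r c = compress m V x' r c" if r: "r \<noteq> i" and c: "c < n" for r c
        unfolding compress_def
      proof (rule sum.cong)
        fix l assume l: "l \<in> {..<m}"
        show "V r l * x (l, c) = V r l * x' (l, c)"
        proof (cases "V r l = 0")
          case False
          then have "V i l = 0" using disjoint r by blast
          then have "(l, c) \<in> ?K - ?I" using l c n by (auto simp: R_def)
          then show ?thesis using eq by simp
        qed simp
      qed simp
      then have "lead_cofactor n (compress m V x) i j = lead_cofactor n (compress m V x') i j" for j
        by (intro lead_cofactor_cong_row n) auto
      then show ?thesis by (simp add: a_def)
    qed
    obtain l where "l < m" "V i l \<noteq> 0" using nonzero[of i] n by auto
    then have l: "l \<in> R" "V i l \<noteq> 0" by (auto simp: R_def)
    show "AE x in gauss_product ?K. \<exists>e\<in>?I. a x e \<noteq> 0"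
      using nz unfolding gauss_matrix_eq
    proof eventually_elim
      case (elim x)
      then obtain j where "j < n" "lead_cofactor n (compress m V x) i j \<noteq> 0" by auto
      then show ?case using l by (intro bexI[of _ "(l, j)"]) (auto simp: a_def)
    qed
  qed simp
  ultimately show ?thesis by (simp add: gauss_matrix_eq)
qed

text \<open>The last cofactor of the last row is the previous leading minor, so induction keeps this row of
  cofactors nonzero.\<close>

lemma AE_leading_minor_nonzero: "n \<le> k \<Longrightarrow> AE x in gauss_matrix m k. lead_det n (compress m V x) \<noteq> 0"
proof (induction n)
  case 0
  then show ?case by (simp add: lead_det_def)
next
  case (Suc n)
  have "AE x in gauss_matrix m k. lead_det n (compress m V x) \<noteq> 0" using Suc by simp
  then have "AE x in gauss_matrix m k. \<exists>j<Suc n. lead_cofactor (Suc n) (compress m V x) n j \<noteq> 0"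
    by eventually_elim (auto intro!: exI[of _ n] simp: lead_cofactor_last)
  \<comment> \<open>With the indicator of 0 as test function, the absence of an atom of the normal
    law at 0 shows that the new minor is almost surely nonzero.\<close>
  then have "(\<integral>\<^sup>+x. indicator {0} (normalized_det m V (Suc n) n x) \<partial>gauss_matrix m k)
      = (\<integral>\<^sup>+z. indicator {0} z \<partial>std_gauss)"
    using Suc.prems by (intro nn_integral_normalized_det) auto
  moreover have "(\<integral>\<^sup>+z. indicator {0} z \<partial>std_gauss) = 0"
    using nn_integral_null_set[OF finite_imp_null_set_lborel[of "{0 :: real}"]]
    by (simp add: emeasure_density)
  moreover have meas: "(\<lambda>x. indicator {0} (normalized_det m V (Suc n) n x) :: ennreal)
      \<in> borel_measurable (gauss_matrix m k)"
    using Suc.prems by (intro measurable_compose[OF measurable_normalized_det]) auto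
  ultimately have "AE x in gauss_matrix m k. indicator {0} (normalized_det m V (Suc n) n x) = (0 :: ennreal)"
    using nn_integral_0_iff_AE[OF meas] by simp
  then show ?case
    by eventually_elim (auto simp: normalized_det_def indicator_def split: if_splits)
qed

lemma nn_integral_cauchy_normalized_det:
  assumes "i < k" "0 < r"
  shows "(\<integral>\<^sup>+x. ennreal (1 / (1 + (r * normalized_det m V k i x)\<^sup>2)) \<partial>gauss_matrix m k)
    \<le> ennreal (sqrt (pi / 2) / r)"
proof -
  \<comment> \<open>Were all cofactors of row \<open>i\<close> zero, expansion along that row would
    make the determinant zero.\<close>
  have "AE x in gauss_matrix m k. \<exists>j<k. lead_cofactor k (compress m V x) i j \<noteq> 0"
    using AE_leading_minor_nonzero[OF order_refl]
  proof eventually_elim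
    case (elim x)
    then show ?case using lead_det_expand_row[OF assms(1), of "compress m V x"] by (metis (no_types, lifting) lessThan_iff mult_zero_right sum.neutral)
  qed
  then have "(\<integral>\<^sup>+x. ennreal (1 / (1 + (r * normalized_det m V k i x)\<^sup>2)) \<partial>gauss_matrix m k)
      = (\<integral>\<^sup>+z. ennreal (1 / (1 + (r * z)\<^sup>2)) \<partial>std_gauss)"
    using assms by (intro nn_integral_normalized_det) auto
  then show ?thesis using nn_integral_cauchy_std_gauss[OF assms(2)] by simp
qed

end

subsection \<open>Digit quantization\<close>

text \<open>Weighting the two values so that they average to \<open>0\<close>, the left-hand side has mean \<open>- lo * hi * C\<close>.\<close>

lemma balanced_step:
  fixes lo hi \<delta> A C :: real
  assumes "lo \<le> 0" "0 \<le> hi" "hi - lo \<le> 2 * \<delta>" "0 \<le> C"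
  shows "\<exists>s\<in>{lo, hi}. 2 * s * A + s\<^sup>2 * C \<le> \<delta>\<^sup>2 * C"
proof (rule ccontr)
  assume "\<not> ?thesis"
  then have lo: "2 * lo * A + lo\<^sup>2 * C > \<delta>\<^sup>2 * C" and hi: "2 * hi * A + hi\<^sup>2 * C > \<delta>\<^sup>2 * C"
    by auto
  have "(hi - lo)\<^sup>2 \<le> (2 * \<delta>)\<^sup>2" using assms by (intro power_mono) auto
  \<comment> \<open>The difference of the two sides is the square of \<open>hi + lo\<close>.\<close>
  moreover have "4 * (- lo * hi) \<le> (hi - lo)\<^sup>2"
    using zero_le_power2[of "hi + lo"] by (simp add: power2_eq_square algebra_simps)
  ultimately have "- lo * hi \<le> \<delta>\<^sup>2" by (simp add: power_mult_distrib)
  then have le: "- lo * hi * C \<le> \<delta>\<^sup>2 * C" using assms by (intro mult_right_mono)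
  show False
  proof (cases "hi = 0 \<and> lo = 0")
    case True
    then have "\<delta>\<^sup>2 * C < 0" using lo by simp
    moreover have "0 \<le> \<delta>\<^sup>2 * C" using assms(4) by (intro mult_nonneg_nonneg) auto
    ultimately show False by linarith
  next
    case False
    then have pos: "hi - lo > 0" using assms by auto
    \<comment> \<open>Before division by \<open>hi - lo\<close>, the averaging weights are
      \<open>hi\<close> for the value \<open>lo\<close> and \<open>- lo\<close> for the value
      \<open>hi\<close>. At least one is positive, so the weighted sum stays strict.\<close>
    have "hi * (\<delta>\<^sup>2 * C) \<le> hi * (2 * lo * A + lo\<^sup>2 * C)" using lo assms by (intro mult_left_mono) auto
    moreover have "- lo * (\<delta>\<^sup>2 * C) \<le> - lo * (2 * hi * A + hi\<^sup>2 * C)"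
      using hi assms by (intro mult_left_mono) auto
    moreover have "hi * (\<delta>\<^sup>2 * C) < hi * (2 * lo * A + lo\<^sup>2 * C)" if "0 < hi"
      using lo that by (rule mult_strict_left_mono)
    moreover have "- lo * (\<delta>\<^sup>2 * C) < - lo * (2 * hi * A + hi\<^sup>2 * C)" if "0 < - lo"
      using hi that by (rule mult_strict_left_mono)
    moreover have "0 < hi \<or> 0 < - lo" using pos by linarith
    ultimately have "(hi - lo) * (\<delta>\<^sup>2 * C) < hi * (2 * lo * A + lo\<^sup>2 * C) - lo * (2 * hi * A + hi\<^sup>2 * C)"
      unfolding left_diff_distrib by linarith
    also have "\<dots> = (hi - lo) * (- lo * hi * C)" by (simp add: power2_eq_square algebra_simps)
    finally show False using le pos mult_left_mono[of "- lo * hi * C" "\<delta>\<^sup>2 * C" "hi - lo"] by linarith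
  qed
qed

text \<open>The roundings are chosen one at a time. \<open>balanced_step\<close>, applied to the
  inner product of the accumulated error with the new row, absorbs the cross term, so the squared
  errors add up as for independent centred roundings.\<close>

lemma balanced_rounding:
  fixes c :: "nat \<Rightarrow> nat \<Rightarrow> real"
  assumes "\<And>i. i < n \<Longrightarrow> lo i \<le> 0" "\<And>i. i < n \<Longrightarrow> 0 \<le> hi i" "\<And>i. i < n \<Longrightarrow> hi i - lo i \<le> 2 * \<delta>"
  shows "\<exists>s. (\<forall>i<n. s i \<in> {lo i, hi i}) \<and>
    (\<Sum>j<k. (\<Sum>i<n. s i * c i j)\<^sup>2) \<le> \<delta>\<^sup>2 * (\<Sum>i<n. \<Sum>j<k. (c i j)\<^sup>2)"
  using assms
proof (induction n)
  case 0
  then show ?case by simp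
next
  case (Suc n)
  have "\<exists>s. (\<forall>i<n. s i \<in> {lo i, hi i}) \<and>
      (\<Sum>j<k. (\<Sum>i<n. s i * c i j)\<^sup>2) \<le> \<delta>\<^sup>2 * (\<Sum>i<n. \<Sum>j<k. (c i j)\<^sup>2)"
    by (rule Suc.IH) (use Suc.prems in auto)
  then obtain s where s: "\<forall>i<n. s i \<in> {lo i, hi i}"
    and le: "(\<Sum>j<k. (\<Sum>i<n. s i * c i j)\<^sup>2) \<le> \<delta>\<^sup>2 * (\<Sum>i<n. \<Sum>j<k. (c i j)\<^sup>2)"
    by blast
  define a where "a j = (\<Sum>i<n. s i * c i j)" for j
  have "\<exists>t\<in>{lo n, hi n}. 2 * t * (\<Sum>j<k. a j * c n j) + t\<^sup>2 * (\<Sum>j<k. (c n j)\<^sup>2)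
      \<le> \<delta>\<^sup>2 * (\<Sum>j<k. (c n j)\<^sup>2)"
    by (rule balanced_step) (use Suc.prems in \<open>simp_all add: sum_nonneg\<close>)
  then obtain t where t: "t \<in> {lo n, hi n}"
    and t_le: "2 * t * (\<Sum>j<k. a j * c n j) + t\<^sup>2 * (\<Sum>j<k. (c n j)\<^sup>2) \<le> \<delta>\<^sup>2 * (\<Sum>j<k. (c n j)\<^sup>2)"
    by blast
  have "(\<Sum>i<Suc n. (s(n := t)) i * c i j) = a j + t * c n j" for j
    unfolding a_def by simp
  then have "(\<Sum>j<k. (\<Sum>i<Suc n. (s(n := t)) i * c i j)\<^sup>2) = (\<Sum>j<k. (a j + t * c n j)\<^sup>2)"
    by simp
  also have "\<dots> = (\<Sum>j<k. (a j)\<^sup>2) + (2 * t * (\<Sum>j<k. a j * c n j) + t\<^sup>2 * (\<Sum>j<k. (c n j)\<^sup>2))"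
  proof -
    have "(a j + t * c n j)\<^sup>2 = (a j)\<^sup>2 + (2 * t * (a j * c n j) + t\<^sup>2 * (c n j)\<^sup>2)" for j
      by (simp add: power2_eq_square algebra_simps)
    then show ?thesis by (simp only: sum.distrib sum_distrib_left)
  qed
  also have "\<dots> \<le> \<delta>\<^sup>2 * (\<Sum>i<n. \<Sum>j<k. (c i j)\<^sup>2) + \<delta>\<^sup>2 * (\<Sum>j<k. (c n j)\<^sup>2)"
    using le t_le unfolding a_def by (rule add_mono)
  also have "\<dots> = \<delta>\<^sup>2 * (\<Sum>i<Suc n. \<Sum>j<k. (c i j)\<^sup>2)"
    by (simp add: distrib_left)
  finally have "(\<Sum>j<k. (\<Sum>i<Suc n. (s(n := t)) i * c i j)\<^sup>2) \<le> \<delta>\<^sup>2 * (\<Sum>i<Suc n. \<Sum>j<k. (c i j)\<^sup>2)" .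
  moreover have "\<forall>i<Suc n. (s(n := t)) i \<in> {lo i, hi i}"
    using s t by (simp add: less_Suc_eq)
  ultimately show ?case by blast
qed

section \<open>Base-\<open>L\<close> expansions and the grid they generate\<close>

lemma digits_exist:
  fixes L :: nat
  assumes "x < L ^ p"
  shows "\<exists>d. (\<forall>r<p. d r < L) \<and> (\<Sum>r<p. L ^ r * d r) = x"
  using assms
proof (induction p arbitrary: x)
  case 0
  then show ?case by simp
next
  case (Suc p)
  then have L: "0 < L" by (cases L) auto
  then obtain d where d: "\<forall>r<p. d r < L" "(\<Sum>r<p. L ^ r * d r) = x mod L ^ p"
    using Suc.IH[of "x mod L ^ p"] by auto
  have "x div L ^ p < L" using Suc.prems by (simp add: less_mult_imp_div_less)
  then show ?case using d
    by (intro exI[of _ "d(p := x div L ^ p)"]) (auto simp: less_Suc_eq)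
qed

definition alphabet :: "nat \<Rightarrow> real \<Rightarrow> real set" where
  "alphabet L Y = (\<lambda>t. 2 * Y / (real L - 1) * real t - Y) ` {..<L}"

lemma card_alphabet:
  assumes "2 \<le> L" "0 < Y"
  shows "finite (alphabet L Y)" "card (alphabet L Y) = L"
  using assms unfolding alphabet_def by (auto intro!: card_image[THEN trans] inj_onI)

text \<open>Digits are mapped affinely to letters, so an expansion becomes an affine function of
  \<open>x\<close>; the offsets \<open>- Y\<close> collect into the geometric sum.\<close>

lemma digit_grid:
  assumes "2 \<le> L" "x < L ^ p"
  shows "\<exists>d. (\<forall>r<p. d r \<in> alphabet L Y) \<and>
    (\<Sum>r<p. real L ^ r * d r) = 2 * Y / (real L - 1) * real x - Y * (\<Sum>r<p. real L ^ r)"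
proof -
  obtain d where d: "\<forall>r<p. d r < L" "(\<Sum>r<p. L ^ r * d r) = x"
    using digits_exist[OF assms(2)] by auto
  have "(\<Sum>r<p. real L ^ r * (2 * Y / (real L - 1) * real (d r) - Y))
      = 2 * Y / (real L - 1) * (\<Sum>r<p. real L ^ r * real (d r)) - Y * (\<Sum>r<p. real L ^ r)"
    by (simp add: right_diff_distrib sum_subtractf sum_distrib_left mult_ac)
  also have "(\<Sum>r<p. real L ^ r * real (d r)) = real x"
    unfolding d(2)[symmetric] by simp
  finally show ?thesis using d(1)
    by (intro exI[of _ "\<lambda>r. 2 * Y / (real L - 1) * real (d r) - Y"]) (auto simp: alphabet_def)
qed

lemma nat_bracket:
  fixes u :: real
  assumes "0 \<le> u" "u \<le> real N" "1 \<le> N"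
  shows "\<exists>n. n + 1 \<le> N \<and> real n \<le> u \<and> u \<le> real n + 1"
proof (cases "u = real N")
  case True
  \<comment> \<open>At the right end the floor is \<open>N\<close> itself, so the last cell is taken
    instead.\<close>
  then show ?thesis using assms by (intro exI[of _ "N - 1"]) (auto simp: of_nat_diff)
next
  case False
  then show ?thesis using assms by (intro exI[of _ "nat \<lfloor>u\<rfloor>"]) (simp, linarith)
qed

text \<open>Words of \<open>p\<close> letters reach \<open>L ^ p\<close> equally spaced values
  filling the allowed range of \<open>y\<close>, so \<open>y\<close> lies between two neighbours.
  \<open>d\<close> encodes the upper and \<open>d'\<close> the lower one, which explains the
  signs.\<close>

lemma digit_bracket:
  assumes L: "2 \<le> L" and p: "1 \<le> p" and Y: "0 < Y" and y: "\<bar>y\<bar> \<le> Y * (\<Sum>r<p. real L ^ r)"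
  shows "\<exists>d d'. (\<forall>r<p. d r \<in> alphabet L Y) \<and> (\<forall>r<p. d' r \<in> alphabet L Y) \<and>
    y - (\<Sum>r<p. real L ^ r * d r) \<le> 0 \<and> 0 \<le> y - (\<Sum>r<p. real L ^ r * d' r) \<and>
    (y - (\<Sum>r<p. real L ^ r * d' r)) - (y - (\<Sum>r<p. real L ^ r * d r)) \<le> 2 * (Y / (real L - 1))"
proof -
  define W where "W = (\<Sum>r<p. real L ^ r)"
  define h where "h = 2 * Y / (real L - 1)"
  have h: "0 < h" using L Y by (simp add: h_def)
  have W: "W = (real L ^ p - 1) / (real L - 1)"
    unfolding W_def using L by (subst geometric_sum) auto
  have "L ^ 1 \<le> L ^ p" using L p by (intro power_increasing) auto
  then have N: "1 \<le> L ^ p - 1" using L by simp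
  have "(y + Y * W) / h \<le> (2 * Y * W) / h"
    using y h by (intro divide_right_mono) (auto simp: W_def)
  \<comment> \<open>By the closed form of \<open>W\<close>, the range has length exactly
    \<open>L ^ p - 1\<close> steps.\<close>
  also have "\<dots> = real (L ^ p - 1)"
    using L Y by (simp add: W h_def of_nat_diff field_simps)
  finally have "(y + Y * W) / h \<le> real (L ^ p - 1)" .
  moreover have "0 \<le> (y + Y * W) / h" using y h by (auto simp: W_def)
  ultimately obtain n where n: "n + 1 \<le> L ^ p - 1" "real n \<le> (y + Y * W) / h" "(y + Y * W) / h \<le> real n + 1"
    using nat_bracket N by blast
  have n2: "h * real n - Y * W \<le> y" "y \<le> h * real (n + 1) - Y * W"
    using n(2,3) h by (auto simp: field_simps)
  have n_less: "n + 1 < L ^ p" "n < L ^ p" using n(1) N by linarith+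
  obtain d where d: "\<forall>r<p. d r \<in> alphabet L Y" "(\<Sum>r<p. real L ^ r * d r) = h * real (n + 1) - Y * W"
    using digit_grid[OF L n_less(1), of Y] unfolding h_def W_def by blast
  obtain d' where d': "\<forall>r<p. d' r \<in> alphabet L Y" "(\<Sum>r<p. real L ^ r * d' r) = h * real n - Y * W"
    using digit_grid[OF L n_less(2), of Y] unfolding h_def W_def by blast
  have "h * real (n + 1) - h * real n = 2 * (Y / (real L - 1))" by (simp add: h_def algebra_simps add_divide_distrib)
  then show ?thesis using d d' n2 by (intro exI[of _ d] exI[of _ d']) auto
qed

text \<open>Index \<open>l\<close> sits at position \<open>l mod p\<close> of block
  \<open>l div p\<close>, so different rows have disjoint supports. Indices from
  \<open>k * p\<close> on fall into blocks numbered at least \<open>k\<close>.\<close>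

definition digit_weight :: "nat \<Rightarrow> nat \<Rightarrow> nat \<Rightarrow> nat \<Rightarrow> real" where
  "digit_weight L p i l = (if l div p = i then real L ^ (l mod p) else 0)"

lemma sum_digit_weight:
  assumes "1 \<le> p" "i < k" "k * p \<le> m"
  shows "(\<Sum>l<m. digit_weight L p i l * g l) = (\<Sum>r<p. real L ^ r * g (i * p + r))"
proof -
  have "i * p + p \<le> k * p" using assms(2) mult_le_mono1[of "Suc i" k p] by simp
  then have im: "i * p + p \<le> m" using assms(3) by simp
  have "(\<Sum>l<m. digit_weight L p i l * g l) = (\<Sum>l\<in>(\<lambda>r. i * p + r) ` {..<p}. digit_weight L p i l * g l)"
  proof (intro sum.mono_neutral_right ballI)
    fix l assume l: "l \<in> {..<m} - (\<lambda>r. i * p + r) ` {..<p}"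
    have "l div p \<noteq> i"
    proof
      assume "l div p = i"
      then have "l = i * p + l mod p" by (metis div_mult_mod_eq)
      then show False using l assms(1) by (metis DiffD2 imageI lessThan_iff mod_less_divisor less_eq_Suc_le One_nat_def)
    qed
    then show "digit_weight L p i l * g l = 0" by (simp add: digit_weight_def)
  qed (use im in auto)
  also have "\<dots> = (\<Sum>r<p. digit_weight L p i (i * p + r) * g (i * p + r))"
    by (subst sum.reindex) (auto simp: inj_on_def)
  also have "\<dots> = (\<Sum>r<p. real L ^ r * g (i * p + r))"
    using assms(1) by (intro sum.cong) (auto simp: digit_weight_def)
  finally show ?thesis .
qed

text \<open>By \<open>inv\<close>, the transpose of \<open>c\<close> inverts \<open>B = V E\<close>,
  so \<open>x - F q\<close> is that inverse applied to \<open>B x - V q\<close>. The row bound keeps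
  every coordinate of \<open>B x\<close> within reach of the grid, and
  \<open>balanced_rounding\<close> controls the resulting error.\<close>

lemma D_s_le_digit_quantization:
  fixes E :: "nat \<Rightarrow> nat \<Rightarrow> real"
  assumes p: "1 \<le> p" "k * p \<le> m" and L: "2 \<le> L" and Y: "0 < Y"
    and rows: "\<And>l. l < m \<Longrightarrow> (\<Sum>j<k. (E l j)\<^sup>2) \<le> Y\<^sup>2"
    and B: "\<And>i j. B i j = (\<Sum>l<m. digit_weight L p i l * E l j)"
    and inv: "\<And>j j'. j < k \<Longrightarrow> j' < k \<Longrightarrow> (\<Sum>i<k. c i j * B i j') = (if j = j' then 1 else 0)"
  shows "D_s k m (\<lambda>j l. \<Sum>i<k. c i j * digit_weight L p i l) (alphabet L Y) (unit_ball k)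
    \<le> ereal (Y / (real L - 1) * sqrt (\<Sum>i<k. \<Sum>j<k. (c i j)\<^sup>2))"
  unfolding D_s_def
proof (rule SUP_least)
  fix x assume x: "x \<in> unit_ball k"
  let ?V = "digit_weight L p" and ?\<delta> = "Y / (real L - 1)"
  define y where "y i = (\<Sum>j<k. B i j * x j)" for i
  have y_eq: "y i = (\<Sum>l<m. ?V i l * (\<Sum>j<k. E l j * x j))" for i
  proof -
    have "y i = (\<Sum>j<k. \<Sum>l<m. ?V i l * E l j * x j)"
      by (simp add: y_def B sum_distrib_right)
    also have "\<dots> = (\<Sum>l<m. \<Sum>j<k. ?V i l * E l j * x j)" by (rule sum.swap)
    finally show ?thesis by (simp add: sum_distrib_left mult.assoc)
  qed
  \<comment> \<open>Cauchy-Schwarz on the unit ball.\<close>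
  have inner: "\<bar>\<Sum>j<k. E l j * x j\<bar> \<le> Y" if "l < m" for l
  proof -
    have "(\<Sum>j<k. (x j)\<^sup>2) \<le> 1" using x by (simp add: unit_ball_def vnorm_def)
    then have "(\<Sum>j<k. (E l j)\<^sup>2) * (\<Sum>j<k. (x j)\<^sup>2) \<le> Y\<^sup>2 * 1"
      using rows[OF that] by (intro mult_mono) (auto simp: sum_nonneg)
    then have "(\<Sum>j<k. E l j * x j)\<^sup>2 \<le> Y\<^sup>2"
      using Cauchy_Schwarz_ineq_sum[of "E l" x "{..<k}"] by linarith
    then show ?thesis using Y by (simp add: abs_le_square_iff[symmetric])
  qed
  have y_le: "\<bar>y i\<bar> \<le> Y * (\<Sum>r<p. real L ^ r)" if "i < k" for i
  proof -
    have "\<bar>y i\<bar> \<le> (\<Sum>l<m. \<bar>?V i l * (\<Sum>j<k. E l j * x j)\<bar>)" unfolding y_eq by (rule sum_abs)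
    also have "\<dots> \<le> (\<Sum>l<m. ?V i l * Y)"
      using inner by (intro sum_mono) (auto simp: abs_mult digit_weight_def intro!: mult_left_mono)
    also have "\<dots> = (\<Sum>r<p. real L ^ r * Y)" by (rule sum_digit_weight) (use p that in auto)
    finally show ?thesis by (simp add: sum_distrib_left mult.commute)
  qed
  define val where "val e = (\<Sum>r<p. real L ^ r * e r)" for e :: "nat \<Rightarrow> real"
  define word where "word e \<longleftrightarrow> (\<forall>r<p. e r \<in> alphabet L Y)" for e
  have "\<exists>d d'. word d \<and> word d' \<and> y i - val d \<le> 0 \<and> 0 \<le> y i - val d' \<and>
    (y i - val d') - (y i - val d) \<le> 2 * ?\<delta>" if "i < k" for i
    using digit_bracket[OF L p(1) Y y_le[OF that]] unfolding val_def word_def .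
  then obtain d d' where dd: "\<And>i. i < k \<Longrightarrow> word (d i)" "\<And>i. i < k \<Longrightarrow> word (d' i)"
    and lo: "\<And>i. i < k \<Longrightarrow> y i - val (d i) \<le> 0"
    and hi: "\<And>i. i < k \<Longrightarrow> 0 \<le> y i - val (d' i)"
    and gap: "\<And>i. i < k \<Longrightarrow> (y i - val (d' i)) - (y i - val (d i)) \<le> 2 * ?\<delta>"
    by metis
  obtain s where s: "\<forall>i<k. s i \<in> {y i - val (d i), y i - val (d' i)}"
    and s_le: "(\<Sum>j<k. (\<Sum>i<k. s i * c i j)\<^sup>2) \<le> ?\<delta>\<^sup>2 * (\<Sum>i<k. \<Sum>j<k. (c i j)\<^sup>2)"
    using balanced_rounding[of k "\<lambda>i. y i - val (d i)" "\<lambda>i. y i - val (d' i)" ?\<delta> c k, OF lo hi gap]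
    by meson
  have "\<exists>e. word e \<and> s i = y i - val e" if "i < k" for i
    using s dd that by blast
  then obtain e where e: "\<And>i. i < k \<Longrightarrow> word (e i)" and s_eq: "\<And>i. i < k \<Longrightarrow> s i = y i - val (e i)"
    by metis
  have "- Y \<in> alphabet L Y" using L by (auto simp: alphabet_def intro!: image_eqI[of _ _ 0])
  \<comment> \<open>Positions beyond the \<open>k\<close> blocks still need a letter, and
    \<open>- Y\<close> serves; from \<open>m\<close> on, admissible words are zero.\<close>
  define q where "q l = (if l < m then if l div p < k then e (l div p) (l mod p) else - Y else 0)" for l
  have q: "q \<in> {q. (\<forall>j<m. q j \<in> alphabet L Y) \<and> (\<forall>j\<ge>m. q j = 0)}"
    using e \<open>- Y \<in> alphabet L Y\<close> p(1) by (auto simp: q_def word_def)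
  have Vq: "(\<Sum>l<m. ?V i l * q l) = val (e i)" if "i < k" for i
  proof -
    have "i * p + p \<le> k * p" using that mult_le_mono1[of "Suc i" k p] by simp
    then have "q (i * p + r) = e i r" if "r < p" for r
      using that \<open>i < k\<close> p by (simp add: q_def)
    then show ?thesis using that p unfolding val_def by (subst sum_digit_weight) (auto intro!: sum.cong)
  qed
  have err: "x j - mat_vec m (\<lambda>j l. \<Sum>i<k. c i j * ?V i l) q j = (\<Sum>i<k. s i * c i j)" if "j < k" for j
  proof -
    have "mat_vec m (\<lambda>j l. \<Sum>i<k. c i j * ?V i l) q j = (\<Sum>l<m. \<Sum>i<k. c i j * ?V i l * q l)"
      by (simp add: mat_vec_def sum_distrib_right)
    also have "\<dots> = (\<Sum>i<k. \<Sum>l<m. c i j * ?V i l * q l)" by (rule sum.swap)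
    also have "\<dots> = (\<Sum>i<k. c i j * val (e i))"
      by (intro sum.cong refl) (simp add: Vq[symmetric] sum_distrib_left mult.assoc)
    finally have 1: "mat_vec m (\<lambda>j l. \<Sum>i<k. c i j * ?V i l) q j = (\<Sum>i<k. c i j * val (e i))" .
    have "(\<Sum>i<k. c i j * y i) = (\<Sum>i<k. \<Sum>j'<k. c i j * B i j' * x j')"
      by (simp add: y_def sum_distrib_left mult.assoc)
    also have "\<dots> = (\<Sum>j'<k. \<Sum>i<k. c i j * B i j' * x j')" by (rule sum.swap)
    also have "\<dots> = (\<Sum>j'<k. (if j = j' then 1 else 0) * x j')"
      using inv that by (intro sum.cong refl) (simp add: sum_distrib_right[symmetric])
    also have "\<dots> = x j" using that by (simp add: if_distrib[of "\<lambda>z. z * _"] cong: if_cong)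
    finally have "x j = (\<Sum>i<k. c i j * y i)" by simp
    then show ?thesis unfolding 1
      by (simp add: s_eq right_diff_distrib sum_subtractf mult.commute)
  qed
  have "vnorm k (\<lambda>j. x j - mat_vec m (\<lambda>j l. \<Sum>i<k. c i j * ?V i l) q j)
      = sqrt (\<Sum>j<k. (\<Sum>i<k. s i * c i j)\<^sup>2)"
    unfolding vnorm_def by (intro arg_cong[where f = sqrt] sum.cong) (auto simp: err)
  also have "\<dots> \<le> sqrt (?\<delta>\<^sup>2 * (\<Sum>i<k. \<Sum>j<k. (c i j)\<^sup>2))" using s_le by simp
  also have "\<dots> = ?\<delta> * sqrt (\<Sum>i<k. \<Sum>j<k. (c i j)\<^sup>2)"
    using Y L by (simp add: real_sqrt_mult)
  finally show "(INF q\<in>{q. (\<forall>j<m. q j \<in> alphabet L Y) \<and> (\<forall>j\<ge>m. q j = 0)}.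
      ereal (vnorm k (\<lambda>i. x i - mat_vec m (\<lambda>j l. \<Sum>i<k. c i j * ?V i l) q i)))
      \<le> ereal (?\<delta> * sqrt (\<Sum>i<k. \<Sum>j<k. (c i j)\<^sup>2))"
    by (intro INF_lower2[OF q]) simp
qed

lemma D_aL_le_digit_quantization:
  fixes E :: "nat \<Rightarrow> nat \<Rightarrow> real"
  assumes p: "1 \<le> p" "k * p \<le> m" and L: "2 \<le> L" and Y: "0 < Y"
    and rows: "\<And>l. l < m \<Longrightarrow> (\<Sum>j<k. (E l j)\<^sup>2) \<le> Y\<^sup>2"
    and B: "\<And>i j. B i j = (\<Sum>l<m. digit_weight L p i l * E l j)"
    and nz: "lead_det k B \<noteq> 0"
  shows "D_aL m k E L \<le> ereal (Y / (real L - 1) * sqrt (\<Sum>i<k. \<Sum>j<k. (lead_cofactor k B i j / lead_det k B)\<^sup>2))"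
proof -
  let ?c = "\<lambda>i j. lead_cofactor k B i j / lead_det k B"
  let ?F = "\<lambda>j l. \<Sum>i<k. ?c i j * digit_weight L p i l"
  have inv: "(\<Sum>i<k. ?c i j * B i j') = (if j = j' then 1 else 0)" if "j < k" "j' < k" for j j'
    using lead_cofactor_orthogonal_columns[OF that, of B] nz by (simp add: sum_divide_distrib[symmetric])
  have "(\<Sum>l<m. ?F j l * E l j') = (\<Sum>i<k. ?c i j * B i j')" for j j'
  proof -
    have "(\<Sum>l<m. ?F j l * E l j') = (\<Sum>l<m. \<Sum>i<k. ?c i j * digit_weight L p i l * E l j')"
      by (simp add: sum_distrib_right)
    also have "\<dots> = (\<Sum>i<k. \<Sum>l<m. ?c i j * digit_weight L p i l * E l j')" by (rule sum.swap)
    finally show ?thesis by (simp add: B sum_distrib_left mult.assoc)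
  qed
  then have F: "?F \<in> {F. \<forall>i<k. \<forall>j<k. (\<Sum>l<m. F i l * E l j) = (if i = j then 1 else 0)}"
    using inv by simp
  have "D_aL m k E L \<le> D_a m k E (alphabet L Y) (unit_ball k)"
    unfolding D_aL_def using card_alphabet[OF L Y] by (intro INF_lower) auto
  also have "\<dots> \<le> D_s k m ?F (alphabet L Y) (unit_ball k)"
    unfolding D_a_def using F by (intro INF_lower)
  also have "\<dots> \<le> ereal (Y / (real L - 1) * sqrt (\<Sum>i<k. \<Sum>j<k. (?c i j)\<^sup>2))"
    by (rule D_s_le_digit_quantization[OF p L Y rows B inv])
  finally show ?thesis .
qed

subsection \<open>The accuracy bound\<close>

text \<open>A zero \<open>z i\<close> alone contributes 1. Otherwise let \<open>T\<close> be the sum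
  of inverse squares: \<open>T * (z i)^2\<close> is at least 1, and if \<open>T\<close> is at least
  \<open>r^2\<close> it also dominates \<open>(r * z i)^2\<close>. Then each term is at least its
  share of \<open>T\<close> divided by 2, and the sum reaches 1/2.\<close>

lemma sum_inverse_squares_less:
  fixes z :: "nat \<Rightarrow> real"
  assumes less: "(\<Sum>i<k. 1 / (1 + (r * z i)\<^sup>2)) < 1 / 2" and r: "0 < r"
  shows "\<And>i. i < k \<Longrightarrow> z i \<noteq> 0" and "(\<Sum>i<k. 1 / (z i)\<^sup>2) < r\<^sup>2"
proof -
  show nz: "z i \<noteq> 0" if "i < k" for i
  proof
    assume "z i = 0"
    then have "1 = 1 / (1 + (r * z i)\<^sup>2)" by simp
    also have "\<dots> \<le> (\<Sum>i<k. 1 / (1 + (r * z i)\<^sup>2))"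
      using that by (intro member_le_sum) auto
    finally show False using less by simp
  qed
  define T where "T = (\<Sum>i<k. 1 / (z i)\<^sup>2)"
  show "(\<Sum>i<k. 1 / (z i)\<^sup>2) < r\<^sup>2"
  proof (rule ccontr)
    assume "\<not> ?thesis"
    then have T: "r\<^sup>2 \<le> T" by (simp add: T_def)
    then have T0: "0 < T" using r by (meson less_le_trans zero_less_power)
    have "1 / (z i)\<^sup>2 / (2 * T) \<le> 1 / (1 + (r * z i)\<^sup>2)" if "i < k" for i
    proof -
      have z: "0 < (z i)\<^sup>2" using nz[OF that] by simp
      have "1 / (z i)\<^sup>2 \<le> T" unfolding T_def using that by (intro member_le_sum) auto
      then have "1 \<le> T * (z i)\<^sup>2" using z by (simp add: field_simps)
      moreover have "r\<^sup>2 * (z i)\<^sup>2 \<le> T * (z i)\<^sup>2" using T by (intro mult_right_mono) auto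
      ultimately have "1 + (r * z i)\<^sup>2 \<le> (z i)\<^sup>2 * (2 * T)" by (simp add: power_mult_distrib mult_ac)
      then have "1 / ((z i)\<^sup>2 * (2 * T)) \<le> 1 / (1 + (r * z i)\<^sup>2)"
        by (intro divide_left_mono mult_pos_pos) (auto simp: add_pos_nonneg z T0)
      then show ?thesis by simp
    qed
    then have "(\<Sum>i<k. 1 / (z i)\<^sup>2 / (2 * T)) \<le> (\<Sum>i<k. 1 / (1 + (r * z i)\<^sup>2))"
      by (intro sum_mono) auto
    moreover have "(\<Sum>i<k. 1 / (z i)\<^sup>2 / (2 * T)) = 1 / 2"
      using T0 unfolding sum_divide_distrib[symmetric] T_def[symmetric] by simp
    ultimately show False using less by simp
  qed
qed

text \<open>Lets the constant \<open>exp 1\<close> of the accuracy bound absorb the factor coming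
  from Markov's inequality.\<close>

lemma sqrt_two_pi_le_e: "sqrt (2 * pi) \<le> exp 1"
proof (rule real_le_lsqrt)
  have "(27 / 10 :: real) \<le> exp 1" using abs_le_D2[OF e_approx_32] by simp
  then have "(27 / 10 :: real)\<^sup>2 \<le> (exp 1)\<^sup>2" by (intro power_mono) auto
  then show "2 * pi \<le> (exp 1)\<^sup>2" using pi_approx(2) by (simp add: power2_eq_square)
qed auto

text \<open>The union bound over the rows: the Chernoff factor is \<open>exp (- 4 * real m)\<close>,
  while \<open>real m\<close> and \<open>sqrt 2 ^ k\<close> cost at most \<open>exp (real m)\<close>
  each.\<close>

lemma row_tail_bound:
  assumes "1 \<le> m" "k \<le> m"
  shows "real m * (exp (- (16 * real m) / 4) * sqrt 2 ^ k) \<le> exp (- 2 * real m)"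
proof -
  have "sqrt 2 ^ k \<le> sqrt 2 ^ m" using assms by (intro power_increasing) auto
  also have "sqrt 2 \<le> exp (1::real)"
    using exp_ge_add_one_self[of "1::real"] sqrt2_less_2 by linarith
  then have "sqrt 2 ^ m \<le> exp 1 ^ m" by (intro power_mono) auto
  also have "exp 1 ^ m = exp (real m)" by (simp add: exp_of_nat_mult[symmetric])
  finally have 1: "sqrt 2 ^ k \<le> exp (real m)" .
  have 2: "real m \<le> exp (real m)" using exp_ge_add_one_self[of "real m"] by linarith
  have "real m * (exp (- (16 * real m) / 4) * sqrt 2 ^ k)
      \<le> exp (real m) * (exp (- (16 * real m) / 4) * exp (real m))"
    using 1 2 by (intro mult_mono) auto
  also have "\<dots> = exp (- 2 * real m)" by (simp flip: exp_add)
  finally show ?thesis .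
qed

theorem theorem3:
  fixes m k L :: nat and \<eta> :: real
  assumes "1 \<le> k" and "k \<le> m" and "2 \<le> L" and "m < 2 * k \<longrightarrow> L > 2"
    and "0 < \<eta>" and "\<eta> < 1 - 1 / (real (m div k) * (real L - 1))"
  shows "\<exists>S\<in>sets (gauss_matrix m k).
     S \<subseteq> {Ent \<in> space (gauss_matrix m k).
            D_aL m k (\<lambda>l j. Ent (l, j)) L
              < ereal (8 * exp 1 * real m powr (3/2) * real L powr (- (1 - \<eta>) * real (m div k)))}
   \<and> measure (gauss_matrix m k) S
       \<ge> 1 - real L powr (- \<eta> * real (m div k)) * exp (\<eta> / (1 - \<eta>)) - exp (- 2 * real m)"
proof -
  define p where "p = m div k"
  let ?M = "gauss_matrix m k" and ?V = "digit_weight L p"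
  have p: "1 \<le> p" "k * p \<le> m"
    using assms(1,2) by (auto simp: p_def div_greater_zero_iff Suc_le_eq)
  have m: "1 \<le> m" using assms by simp
  \<comment> \<open>Chosen so that \<open>real m * exp 1 / r\<close> equals the permitted failure
    probability \<open>real L powr (- \<eta> * real p)\<close>.\<close>
  define r where "r = exp 1 * real m * real L powr (\<eta> * real p)"
  have r: "0 < r" using m assms(3) by (simp add: r_def)
  \<comment> \<open>The threshold \<open>16 * real m\<close> for squared row norms is the one
    handled by \<open>row_tail_bound\<close>.\<close>
  define Y where "Y = 4 * sqrt (real m)"
  have Y: "0 < Y" "Y\<^sup>2 = 16 * real m" using m by (auto simp: Y_def power_mult_distrib)
  let ?Z = "normalized_det m ?V k"
  define h where "h x = (\<Sum>i<k. 1 / (1 + (r * ?Z i x)\<^sup>2))" for x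
  interpret prob_space ?M unfolding gauss_matrix_eq by (rule prob_space_gauss_product)

  \<comment> \<open>Properties of the digit weights\<close>
  have disjoint: "i = i'" if "?V i l \<noteq> 0" "?V i' l \<noteq> 0" for i i' l
    using that by (auto simp: digit_weight_def split: if_splits)
  \<comment> \<open>The squared norm of a weight row is at least its largest term.\<close>
  have sq: "(real L ^ (p - 1))\<^sup>2 \<le> (\<Sum>l<m. (?V i l)\<^sup>2)" if "i < k" for i
  proof -
    have "(\<Sum>l<m. (?V i l)\<^sup>2) = (\<Sum>r<p. real L ^ r * ?V i (i * p + r))"
      unfolding power2_eq_square using that p by (intro sum_digit_weight)
    also have "\<dots> = (\<Sum>r<p. (real L ^ r)\<^sup>2)"
      using p by (intro sum.cong) (auto simp: digit_weight_def power2_eq_square)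
    finally show ?thesis
      using p member_le_sum[of "p - 1" "{..<p}" "\<lambda>r. (real L ^ r)\<^sup>2"] by simp
  qed
  have "0 < (real L ^ (p - 1))\<^sup>2" using assms(3) by simp
  have nonzero: "\<exists>l<m. ?V i l \<noteq> 0" if "i < k" for i
  proof (rule ccontr)
    assume "\<not> ?thesis"
    then have "(\<Sum>l<m. (?V i l)\<^sup>2) = 0" by simp
    then show False using sq[OF that] \<open>0 < (real L ^ (p - 1))\<^sup>2\<close> by simp
  qed

  have Zm: "?Z i \<in> borel_measurable ?M" if "i \<in> {..<k}" for i
    using that by (intro measurable_normalized_det) auto
  have hm[measurable]: "h \<in> borel_measurable ?M"
    unfolding h_def using Zm by measurable
  have rm: "(\<lambda>x. \<Sum>j<k. (x (l, j))\<^sup>2) \<in> borel_measurable ?M" if "l < m" for l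
    using that by (intro borel_measurable_sum borel_measurable_power measurable_gauss_matrix_entry) auto

  \<comment> \<open>Probability of the bad events\<close>
  define R where "R l = {x\<in>space ?M. 16 * real m \<le> (\<Sum>j<k. (x (l, j))\<^sup>2)}" for l
  define Q where "Q = {x\<in>space ?M. 1 / 2 \<le> h x}"
  have Rs: "R l \<in> events" if "l < m" for l
    unfolding R_def by (intro borel_measurable_le borel_measurable_const rm that)
  have Qs: "Q \<in> events" unfolding Q_def by measurable
  have Rp: "prob (R l) \<le> exp (- (16 * real m) / 4) * sqrt 2 ^ k" if "l < m" for l
  proof -
    have "(\<Sum>e\<in>{l} \<times> {..<k}. (x e)\<^sup>2) = (\<Sum>j<k. (x (l, j))\<^sup>2)" for x :: "nat \<times> nat \<Rightarrow> real"
      using sum.cartesian_product[of "\<lambda>l j. (x (l, j))\<^sup>2" "{..<k}" "{l}"] by (simp add: split_def)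
    then have "emeasure ?M (R l) \<le> ennreal (exp (- (16 * real m) / 4) * sqrt 2 ^ card ({l} \<times> {..<k}))"
      using emeasure_gauss_product_sum_squares_le[of "{..<m} \<times> {..<k}" "{l} \<times> {..<k}" "16 * real m"] that
      unfolding R_def gauss_matrix_eq by auto
    then show ?thesis by (simp add: emeasure_eq_measure card_cartesian_product)
  qed
  have Up: "prob (\<Union>l<m. R l) \<le> exp (- 2 * real m)"
  proof -
    have "prob (\<Union>l<m. R l) \<le> (\<Sum>l<m. prob (R l))"
      using Rs by (intro finite_measure_subadditive_finite) auto
    also have "\<dots> \<le> (\<Sum>l<m. exp (- (16 * real m) / 4) * sqrt 2 ^ k)" using Rp by (intro sum_mono) auto
    also have "\<dots> = real m * (exp (- (16 * real m) / 4) * sqrt 2 ^ k)" by simp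
    also have "\<dots> \<le> exp (- 2 * real m)" by (rule row_tail_bound[OF m assms(2)])
    finally show ?thesis .
  qed
  have Qp: "prob Q \<le> real L powr (- \<eta> * real p)"
  proof -
    have h2: "1 \<le> ennreal 2 * ennreal (h x) \<longleftrightarrow> 1 / 2 \<le> h x" for x
    proof -
      have "0 \<le> h x" unfolding h_def by (intro sum_nonneg) simp
      then have "ennreal 2 * ennreal (h x) = ennreal (2 * h x)"
        by (intro ennreal_mult[symmetric]) auto
      then show ?thesis by (auto simp only: ennreal_ge_1)
    qed
    have "ennreal (prob Q) = emeasure ?M {x\<in>space ?M. 1 \<le> ennreal 2 * ennreal (h x)}"
      by (simp only: emeasure_eq_measure[symmetric] Q_def h2)
    also have "\<dots> \<le> ennreal 2 * (\<integral>\<^sup>+x. ennreal (h x) * indicator (space ?M) x \<partial>?M)"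
      by (rule nn_integral_Markov_inequality) auto
    also have "(\<integral>\<^sup>+x. ennreal (h x) * indicator (space ?M) x \<partial>?M) = (\<integral>\<^sup>+x. ennreal (h x) \<partial>?M)"
      by (intro nn_integral_cong) auto
    also have "\<dots> = (\<integral>\<^sup>+x. (\<Sum>i<k. ennreal (1 / (1 + (r * ?Z i x)\<^sup>2))) \<partial>?M)"
      unfolding h_def by (subst sum_ennreal) auto
    \<comment> \<open>Linearity suffices here, so the dependence between the \<open>?Z i\<close>
      does no harm.\<close>
    also have "\<dots> = (\<Sum>i<k. \<integral>\<^sup>+x. ennreal (1 / (1 + (r * ?Z i x)\<^sup>2)) \<partial>?M)"
      using Zm by (intro nn_integral_sum) measurable
    also have "\<dots> \<le> (\<Sum>i<k. ennreal (sqrt (pi / 2) / r))"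
      by (intro sum_mono nn_integral_cauchy_normalized_det[OF disjoint nonzero]) (use r in auto)
    also have "\<dots> = ennreal (real k * (sqrt (pi / 2) / r))"
      using r by (subst ennreal_mult) (auto simp: ennreal_of_nat_eq_real_of_nat)
    finally have "ennreal (prob Q) \<le> ennreal 2 * ennreal (real k * (sqrt (pi / 2) / r))"
      by (simp add: mult_left_mono)
    also have "\<dots> = ennreal (2 * (real k * (sqrt (pi / 2) / r)))"
      using r by (intro ennreal_mult[symmetric]) auto
    finally have "prob Q \<le> 2 * (real k * (sqrt (pi / 2) / r))"
      using r by (subst (asm) ennreal_le_iff) auto
    also have "\<dots> = real k * sqrt (2 * pi) / r"
      using real_sqrt_mult[of 4 "pi / 2"] by simp
    also have "\<dots> \<le> real m * exp 1 / r"
      using assms(2) r sqrt_two_pi_le_e by (intro divide_right_mono mult_mono) auto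
    also have "\<dots> = real L powr (- \<eta> * real p)"
      using m by (simp add: r_def powr_minus field_simps)
    finally show ?thesis .
  qed

  define S where "S = space ?M - (Q \<union> (\<Union>l<m. R l))"
  have Us: "(\<Union>l<m. R l) \<in> events" using Rs by (intro sets.finite_UN) auto
  have Ss: "S \<in> events" unfolding S_def using Qs Us by auto
  have "prob S = 1 - prob (Q \<union> (\<Union>l<m. R l))"
    unfolding S_def using Qs Us by (intro prob_compl) auto
  moreover have "prob (Q \<union> (\<Union>l<m. R l)) \<le> prob Q + prob (\<Union>l<m. R l)"
    using Qs Us by (rule measure_Un_le)
  moreover have "\<eta> < 1"
  proof -
    have "0 \<le> 1 / (real (m div k) * (real L - 1))" using assms(3) by simp
    then show ?thesis using assms(6) by linarith
  qed
  \<comment> \<open>As \<eta> lies between 0 and 1, the exponential factor is at least 1 and only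
    enlarges the bound on \<open>prob Q\<close>.\<close>
  then have "1 \<le> exp (\<eta> / (1 - \<eta>))" using assms(5) by simp
  then have "real L powr (- \<eta> * real p) * 1 \<le> real L powr (- \<eta> * real p) * exp (\<eta> / (1 - \<eta>))"
    by (intro mult_left_mono) auto
  ultimately have probS: "prob S \<ge> 1 - real L powr (- \<eta> * real p) * exp (\<eta> / (1 - \<eta>)) - exp (- 2 * real m)"
    using Qp Up by linarith

  \<comment> \<open>Deterministic estimate on the good event\<close>
  have "D_aL m k (\<lambda>l j. x (l, j)) L
      < ereal (8 * exp 1 * real m powr (3/2) * real L powr (- (1 - \<eta>) * real p))" if x: "x \<in> S" for x
  proof -
    let ?B = "compress m ?V x"
    define N where "N i = (\<Sum>l<m. (?V i l)\<^sup>2)" for i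
    define C where "C i = (\<Sum>j<k. (lead_cofactor k ?B i j)\<^sup>2)" for i
    have xs: "x \<in> space ?M" and hx: "h x < 1 / 2"
      using x by (auto simp: S_def Q_def)
    have rows: "(\<Sum>j<k. (x (l, j))\<^sup>2) \<le> Y\<^sup>2" if "l < m" for l
      using x xs that by (auto simp: S_def R_def Y(2) not_le intro: less_imp_le)
    have Znz: "?Z i x \<noteq> 0" if "i < k" for i
      using sum_inverse_squares_less(1)[OF hx[unfolded h_def] r that] .
    have Zsum: "(\<Sum>i<k. 1 / (?Z i x)\<^sup>2) < r\<^sup>2"
      using sum_inverse_squares_less(2)[OF hx[unfolded h_def] r] .
    have nz: "lead_det k ?B \<noteq> 0" using Znz[of 0] assms(1) by (auto simp: normalized_det_def)
    \<comment> \<open>\<open>C i\<close> over the squared determinant is the contribution of row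
      \<open>i\<close> of cofactors to the squared Frobenius norm of the inverse.\<close>
    have Z_eq: "1 / (?Z i x)\<^sup>2 = N i * (C i / (lead_det k ?B)\<^sup>2)" for i
      by (simp add: normalized_det_def N_def C_def power_divide power_mult_distrib sum_nonneg)
    have "(real L ^ (p - 1))\<^sup>2 * (\<Sum>i<k. \<Sum>j<k. (lead_cofactor k ?B i j / lead_det k ?B)\<^sup>2)
        = (\<Sum>i<k. (real L ^ (p - 1))\<^sup>2 * (C i / (lead_det k ?B)\<^sup>2))"
      by (simp add: C_def power_divide sum_divide_distrib sum_distrib_left)
    also have "\<dots> \<le> (\<Sum>i<k. N i * (C i / (lead_det k ?B)\<^sup>2))"
      using sq by (intro sum_mono mult_right_mono) (auto simp: N_def C_def sum_nonneg)
    also have "\<dots> < r\<^sup>2" using Zsum by (simp add: Z_eq)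
    finally have "sqrt ((real L ^ (p - 1))\<^sup>2 * (\<Sum>i<k. \<Sum>j<k. (lead_cofactor k ?B i j / lead_det k ?B)\<^sup>2)) < sqrt (r\<^sup>2)"
      by (rule real_sqrt_less_mono)
    then have "real L ^ (p - 1) * sqrt (\<Sum>i<k. \<Sum>j<k. (lead_cofactor k ?B i j / lead_det k ?B)\<^sup>2) < r"
      using r by (simp add: real_sqrt_mult)
    then have fro: "sqrt (\<Sum>i<k. \<Sum>j<k. (lead_cofactor k ?B i j / lead_det k ?B)\<^sup>2) < r / real L ^ (p - 1)"
      using assms(3) by (simp add: pos_less_divide_eq mult.commute)
    have "D_aL m k (\<lambda>l j. x (l, j)) L
        \<le> ereal (Y / (real L - 1) * sqrt (\<Sum>i<k. \<Sum>j<k. (lead_cofactor k ?B i j / lead_det k ?B)\<^sup>2))"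
      by (rule D_aL_le_digit_quantization[OF p assms(3) Y(1) rows _ nz]) (auto simp: compress_def)
    also have "\<dots> < ereal (Y / (real L - 1) * (r / real L ^ (p - 1)))"
      unfolding less_ereal.simps(1) using Y(1) assms(3) by (intro mult_strict_left_mono fro) auto
    \<comment> \<open>For \<open>L\<close> at least 2, \<open>real L - 1\<close> is at least
      \<open>real L / 2\<close>. The resulting factor 2 and the 4 in \<open>Y\<close> give the
      constant 8, and the spare \<open>L\<close> completes \<open>L ^ (p - 1)\<close> to
      \<open>L ^ p\<close>.\<close>
    also have "\<dots> \<le> ereal (Y / (real L / 2) * (r / real L ^ (p - 1)))"
      unfolding ereal_less_eq(3) using Y(1) r assms(3)
      by (intro mult_right_mono divide_left_mono mult_pos_pos) auto
    also have "Y / (real L / 2) * (r / real L ^ (p - 1)) = 2 * Y * r / real L ^ p"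
      using p(1) by (cases p) auto
    also have "\<dots> = 8 * exp 1 * (real m * sqrt (real m)) * (real L powr (\<eta> * real p) / real L ^ p)"
      by (simp add: Y_def r_def)
    also have "real m * sqrt (real m) = real m powr (3/2)"
      using m powr_add[of "real m" 1 "1/2"] by (simp add: powr_half_sqrt)
    also have "real L powr (\<eta> * real p) / real L ^ p = real L powr (- (1 - \<eta>) * real p)"
      using assms(3) by (simp add: powr_diff powr_realpow[symmetric] left_diff_distrib)
    finally show ?thesis .
  qed
  moreover have "S \<subseteq> space ?M" by (auto simp: S_def)
  ultimately show ?thesis using Ss probS unfolding p_def by blast
qed

end
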